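(* Let $p\ge 1$, let $m\in\mathbb{R}^p$, let $S$ be a positive definite diagonal real $p\times p$ matrix, and let $\mathcal{D}\subseteq\mathbb{R}^p$ be a scone. Let $\mathcal{S}^0=\{\lambda\in\mathbb{R}^p : \lambda' S\lambda=1\}\cup\{0\}$. Suppose that $$\widehat{\lambda}=\arg\max_{\lambda\in\mathcal{S}^0\cap\mathcal{D}} m'\lambda\qquad\text{and}\qquad \widehat{\beta}=\arg\min_{\beta\in\mathcal{D}}\bigl\|S^{-1/2}m-\beta\bigr\|_2^2$$ are unique optimizers (i.e. each optimization problem has exactly one optimizer, denoted $\widehat\lambda$ and $\widehat\beta$ respectively). Then $$\widehat{\lambda}=\frac{S^{-1/2}\widehat{\beta}}{\sqrt{\widehat{\beta}'\widehat{\beta}}}\quad\text{if }\widehat{\beta}\neq 0,\qquad\text{and}\qquad \widehat{\lambda}=0\quad\text{otherwise.}$$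
   Context: A scone ("sign cone") in $\mathbb{R}^p$ is a set $\mathcal{D}\subseteq\mathbb{R}^p$ closed under multiplication by positive definite diagonal matrices: if $\lambda\in\mathcal{D}$ and $D$ is a diagonal $p\times p$ matrix with strictly positive diagonal entries, then $D\lambda\in\mathcal{D}$. A prime denotes transpose, $\|\cdot\|_2$ is the Euclidean norm, and $S^{-1/2}$ is the diagonal matrix whose diagonal entries are $S_{jj}^{-1/2}$. *)

theory Defs
  imports "HOL-Analysis.Analysis"
begin

definition diagonal_matrix :: "real ^ 'p ^ 'p \<Rightarrow> bool" where
  "diagonal_matrix A \<longleftrightarrow> (\<forall>i j. i \<noteq> j \<longrightarrow> A $ i $ j = 0)"

definition positive_definite :: "real ^ 'p ^ 'p \<Rightarrow> bool" where
  "positive_definite A \<longleftrightarrow> transpose A = A \<and> (\<forall>x. x \<noteq> 0 \<longrightarrow> x \<bullet> (A *v x) > 0)"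

(* Neither convexity, closedness nor membership of 0 is required. *)
definition scone :: "(real ^ 'p) set \<Rightarrow> bool" where
  "scone C \<longleftrightarrow>
     (\<forall>x\<in>C. \<forall>A. diagonal_matrix A \<and> (\<forall>i. A $ i $ i > 0) \<longrightarrow> A *v x \<in> C)"

(* Only meaningful for a diagonal matrix with positive diagonal entries:
   the off-diagonal entries of S are ignored. *)
definition inv_sqrt_diag :: "real ^ 'p ^ 'p \<Rightarrow> real ^ 'p ^ 'p" where
  "inv_sqrt_diag S = (\<chi> i j. if i = j then (S $ i $ i) powr (- 1 / 2) else 0)"

definition sphere0 :: "real ^ 'p ^ 'p \<Rightarrow> (real ^ 'p) set" where
  "sphere0 S = {l. l \<bullet> (S *v l) = 1} \<union> {0}"

end

theory Submission
  imports Defs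
begin

text \<open>
  Write \<open>R\<close> for \<open>S\<^sup>-\<^sup>1\<^sup>/\<^sup>2\<close> and \<open>z = R m\<close>. Since \<open>R\<close> and its inverse are positive diagonal matrices,
  both map the scone \<open>D\<close> into itself, so \<open>\<lambda> = R b\<close> identifies the nonzero points of
  \<open>sphere0 S \<inter> D\<close> with the unit vectors \<open>b\<close> of \<open>D\<close>, and \<open>m \<bullet> \<lambda> = z \<bullet> b\<close>. The first problem
  therefore maximises \<open>z \<bullet> b\<close> over the unit vectors of \<open>D\<close>, with the origin as a further candidate
  of value \<open>0\<close> if it lies in \<open>D\<close>.

  The second problem becomes the same one once every ray of \<open>D\<close> is optimised separately: a scone
  contains the open ray through each of its points, and for a unit vector \<open>b\<close> with
  \<open>z \<bullet> b > 0\<close> the point of the ray nearest to \<open>z\<close> is \<open>(z \<bullet> b) b\<close>, at squared distance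
  \<open>\<parallel>z\<parallel>\<^sup>2 - (z \<bullet> b)\<^sup>2\<close>. Hence a nearest point \<open>\<beta>\<close> satisfies \<open>z \<bullet> \<beta> = \<beta> \<bullet> \<beta>\<close>
  (\<open>nearest_point_orthogonal\<close>) and \<open>\<parallel>\<beta>\<parallel>\<close> bounds \<open>z \<bullet> b\<close> for all unit vectors \<open>b\<close> of \<open>D\<close>
  (\<open>inner_le_norm_nearest_point\<close>). The bound is attained at \<open>b = \<beta> / \<parallel>\<beta>\<parallel>\<close>, or at the origin if
  \<open>\<beta> = 0\<close>. The vector claimed for \<open>\<lambda>\<close> is thus a maximiser, and the maximiser is unique by
  assumption.
\<close>

lemma is_arg_min_norm_le:
  fixes z b x :: "'a :: real_normed_vector"
  assumes "is_arg_min (\<lambda>b. (norm (z - b))\<^sup>2) (\<lambda>b. b \<in> D) b" "x \<in> D"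
  shows "(norm (z - b))\<^sup>2 \<le> (norm (z - x))\<^sup>2"
  using assms by (auto simp: is_arg_min_linorder)

lemma power2_norm_diff_scaleR:
  fixes z b :: "'a :: real_inner"
  shows "(norm (z - t *\<^sub>R b))\<^sup>2 = z \<bullet> z - 2 * t * (z \<bullet> b) + t\<^sup>2 * (b \<bullet> b)"
  unfolding power2_norm_eq_inner
  by (simp add: inner_diff_left inner_diff_right inner_commute power2_eq_square algebra_simps)

text \<open>
  The squared distance from \<open>z\<close> to \<open>t *\<^sub>R b\<close> is a quadratic in \<open>t\<close> that is minimal at the interior
  point \<open>t = 1\<close> of the ray, so its derivative vanishes there.
\<close>

lemma nearest_point_orthogonal:
  fixes z b :: "'a :: real_inner"
  assumes cone: "\<And>x t. x \<in> D \<Longrightarrow> t > 0 \<Longrightarrow> t *\<^sub>R x \<in> D"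
    and min: "is_arg_min (\<lambda>b. (norm (z - b))\<^sup>2) (\<lambda>b. b \<in> D) b"
  shows "z \<bullet> b = b \<bullet> b"
proof -
  define f where "f t = z \<bullet> z - 2 * t * (z \<bullet> b) + t\<^sup>2 * (b \<bullet> b)" for t :: real
  have "b \<in> D"
    using min by (simp add: is_arg_min_def)
  have "f 1 \<le> f t" if "t > 0" for t
    using is_arg_min_norm_le[OF min cone[OF \<open>b \<in> D\<close> that]]
      power2_norm_diff_scaleR[of z 1 b] power2_norm_diff_scaleR[of z t b]
    by (simp add: f_def)
  then have "\<forall>t. \<bar>1 - t\<bar> < 1 \<longrightarrow> f 1 \<le> f t"
    by auto
  moreover have "DERIV f 1 :> - 2 * (z \<bullet> b) + 2 * (b \<bullet> b)"
    unfolding f_def by (auto intro!: derivative_eq_intros)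
  ultimately have "- 2 * (z \<bullet> b) + 2 * (b \<bullet> b) = 0"
    using DERIV_local_min zero_less_one by blast
  then show ?thesis
    by simp
qed

text \<open>
  Otherwise the foot \<open>(z \<bullet> x) *\<^sub>R x\<close> of the perpendicular from \<open>z\<close> would lie on the open ray through
  \<open>x\<close> and be closer to \<open>z\<close> than \<open>b\<close> is.
\<close>

lemma inner_le_norm_nearest_point:
  fixes z b x :: "'a :: real_inner"
  assumes cone: "\<And>x t. x \<in> D \<Longrightarrow> t > 0 \<Longrightarrow> t *\<^sub>R x \<in> D"
    and min: "is_arg_min (\<lambda>b. (norm (z - b))\<^sup>2) (\<lambda>b. b \<in> D) b"
    and x: "x \<in> D" "x \<bullet> x = 1"
  shows "z \<bullet> x \<le> norm b"
proof (rule ccontr)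
  assume "\<not> z \<bullet> x \<le> norm b"
  then have gt: "norm b < z \<bullet> x"
    by simp
  then have "z \<bullet> x > 0"
    using norm_ge_zero[of b] by linarith
  from is_arg_min_norm_le[OF min cone[OF x(1) this]] have "(z \<bullet> x)\<^sup>2 \<le> b \<bullet> b"
    using power2_norm_diff_scaleR[of z 1 b] power2_norm_diff_scaleR[of z "z \<bullet> x" x]
      nearest_point_orthogonal[OF cone min] x(2)
    by (simp add: power2_eq_square)
  moreover have "b \<bullet> b < (z \<bullet> x)\<^sup>2"
    using power_strict_mono[OF gt, of 2] by (simp add: power2_norm_eq_inner)
  ultimately show False
    by simp
qed

lemma scone_componentwise:
  fixes x :: "real ^ 'p"
  assumes "scone D" "x \<in> D" "\<And>i. c i > 0"
  shows "(\<chi> i. c i * x $ i) \<in> D"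
proof -
  define A :: "real ^ 'p ^ 'p" where "A = (\<chi> i j. if i = j then c i else 0)"
  have "A *v x \<in> D"
    using assms unfolding scone_def by (auto simp: A_def diagonal_matrix_def)
  moreover have "A *v x = (\<chi> i. c i * x $ i)"
    by (simp add: A_def matrix_vector_mult_def vec_eq_iff if_distrib[of "\<lambda>a. a * _"] cong: if_cong)
  ultimately show ?thesis
    by simp
qed

lemma scone_scaleR:
  assumes "scone D" "x \<in> D" "t > 0"
  shows "t *\<^sub>R x \<in> D"
  using scone_componentwise[OF assms(1,2), of "\<lambda>_. t"] assms(3)
  by (simp add: scaleR_vec_def)

lemma diagonal_matrix_vector_mult_nth:
  assumes "diagonal_matrix A"
  shows "(A *v x) $ i = A $ i $ i * x $ i"
proof -
  have "(A *v x) $ i = (\<Sum>j\<in>UNIV. if j = i then A $ i $ i * x $ i else 0)"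
    unfolding matrix_vector_mult_def vec_lambda_beta
    using assms by (intro sum.cong) (auto simp: diagonal_matrix_def)
  then show ?thesis
    by simp
qed

lemma positive_definite_diag_pos:
  assumes "positive_definite A"
  shows "A $ i $ i > 0"
proof -
  have "axis i 1 \<bullet> (A *v axis i 1) > 0"
    using assms by (simp add: positive_definite_def axis_eq_0_iff)
  then show ?thesis
    by (simp add: inner_axis' matrix_vector_mul_component inner_axis)
qed

lemma inv_sqrt_diag_mult_nth:
  assumes "S $ i $ i > 0"
  shows "(inv_sqrt_diag S *v x) $ i = x $ i / sqrt (S $ i $ i)"
proof -
  have "diagonal_matrix (inv_sqrt_diag S)"
    by (simp add: diagonal_matrix_def inv_sqrt_diag_def)
  from diagonal_matrix_vector_mult_nth[OF this] show ?thesis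
    using assms by (simp add: inv_sqrt_diag_def powr_minus powr_half_sqrt field_simps)
qed

theorem proposition2:
  fixes m :: "real ^ 'p"
    and S :: "real ^ 'p ^ 'p"
    and D :: "(real ^ 'p) set"
    and lambda_hat beta_hat :: "real ^ 'p"
  assumes "diagonal_matrix S"
    and "positive_definite S"
    and "scone D"
    and "is_arg_max (\<lambda>l. m \<bullet> l) (\<lambda>l. l \<in> sphere0 S \<inter> D) lambda_hat"
    and "\<exists>!l. is_arg_max (\<lambda>l. m \<bullet> l) (\<lambda>l. l \<in> sphere0 S \<inter> D) l"
    and "is_arg_min (\<lambda>b. (norm (inv_sqrt_diag S *v m - b))\<^sup>2) (\<lambda>b. b \<in> D) beta_hat"
    and "\<exists>!b. is_arg_min (\<lambda>b. (norm (inv_sqrt_diag S *v m - b))\<^sup>2) (\<lambda>b. b \<in> D) b"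
  shows "(beta_hat \<noteq> 0 \<longrightarrow>
            lambda_hat = (1 / sqrt (beta_hat \<bullet> beta_hat)) *\<^sub>R (inv_sqrt_diag S *v beta_hat)) \<and>
         (beta_hat = 0 \<longrightarrow> lambda_hat = 0)"
proof -
  let ?R = "inv_sqrt_diag S"
  let ?z = "?R *v m"
  have pos: "S $ i $ i > 0" for i
    using assms(2) by (rule positive_definite_diag_pos)
  note R_nth = inv_sqrt_diag_mult_nth[OF pos]
  note cone = scone_scaleR[OF assms(3)]
  have R_adjoint: "m \<bullet> (?R *v b) = ?z \<bullet> b" for b
    by (simp add: inner_vec_def R_nth)
  have R_isometry: "(?R *v b) \<bullet> (S *v (?R *v b)) = b \<bullet> b" for b
  proof -
    have "b $ i / sqrt (S $ i $ i) * (S $ i $ i * (b $ i / sqrt (S $ i $ i))) = b $ i * b $ i" for i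
      using pos[of i] by (simp add: field_simps)
    then show ?thesis
      by (simp add: inner_vec_def R_nth diagonal_matrix_vector_mult_nth[OF assms(1)])
  qed
  have R_in: "?R *v b \<in> D" if "b \<in> D" for b
  proof -
    have "?R *v b = (\<chi> i. (1 / sqrt (S $ i $ i)) * b $ i)"
      by (simp add: vec_eq_iff R_nth)
    then show ?thesis
      using scone_componentwise[OF assms(3) that, of "\<lambda>i. 1 / sqrt (S $ i $ i)"] pos by simp
  qed
  have beta_in: "beta_hat \<in> D"
    using assms(6) by (simp add: is_arg_min_def)
  have upper: "m \<bullet> l \<le> norm beta_hat" if l: "l \<in> sphere0 S \<inter> D" for l
  proof (cases "l = 0")
    case False
    \<comment> \<open>\<open>b\<close> is \<open>S\<^sup>1\<^sup>/\<^sup>2 l\<close>.\<close>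
    define b where "b = (\<chi> i. sqrt (S $ i $ i) * l $ i)"
    have "b \<in> D"
      unfolding b_def using l pos by (intro scone_componentwise[OF assms(3)]) auto
    moreover have Rb: "?R *v b = l"
      using pos by (simp add: vec_eq_iff R_nth b_def less_imp_neq[symmetric])
    moreover have "b \<bullet> b = 1"
      using R_isometry[of b] l False by (simp add: Rb sphere0_def)
    ultimately show ?thesis
      using inner_le_norm_nearest_point[OF cone assms(6)] R_adjoint[of b] by simp
  qed simp
  have unique: "lambda_hat = l"
    if "l \<in> sphere0 S \<inter> D" "m \<bullet> l = norm beta_hat" for l
  proof -
    have "is_arg_max (\<lambda>l. m \<bullet> l) (\<lambda>l. l \<in> sphere0 S \<inter> D) l"
      using that upper by (auto simp: is_arg_max_linorder)
    then show ?thesis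
      using assms(4,5) by blast
  qed
  show ?thesis
  proof (intro conjI impI)
    assume nz: "beta_hat \<noteq> 0"
    define u where "u = (1 / norm beta_hat) *\<^sub>R beta_hat"
    have "u \<in> D"
      unfolding u_def using nz by (intro cone beta_in) simp
    moreover have "u \<bullet> u = 1"
      using nz by (simp add: u_def dot_square_norm power2_eq_square)
    ultimately have "?R *v u \<in> sphere0 S \<inter> D"
      using R_in R_isometry[of u] by (simp add: sphere0_def)
    moreover have "m \<bullet> (?R *v u) = norm beta_hat"
      using nz nearest_point_orthogonal[OF cone assms(6)]
      by (simp add: R_adjoint u_def dot_square_norm power2_eq_square)
    ultimately have "lambda_hat = ?R *v u"
      by (rule unique)
    then show "lambda_hat = (1 / sqrt (beta_hat \<bullet> beta_hat)) *\<^sub>R (?R *v beta_hat)"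
      by (simp add: u_def norm_eq_sqrt_inner matrix_vector_mult_scaleR)
  next
    assume "beta_hat = 0"
    then show "lambda_hat = 0"
      using beta_in by (intro unique) (auto simp: sphere0_def)
  qed
qed

end
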